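(* Let $G$ be a finite group with $|G|>1$ and let $H$ be a subgroup of $G$. Let $\pi$ denote the Plancherel measure of $G$. Let $$\beta = \max_{g \neq 1} \frac{|g^G \cap H|}{|g^G|} = \frac{|H|}{|G|} \max_{g \neq 1} \mathrm{Ind}_H^G(1)[g],$$ where the maxima are over the non-identity elements $g\in G$. Then, for every positive integer $r$, $$\sum_{\rho \in \mathrm{Irr}(G)} \left| \left(\frac{|H|}{|G|}\right)^r \dim(\rho)\, \langle \chi^{\rho}, (\mathrm{Ind}_{H}^G(1))^r \rangle - \pi(\rho)\right| \leq |G|^{1/2} \beta^r.$$
   Context: $\mathrm{Irr}(G)$ is the set of (isomorphism classes of) complex irreducible representations of $G$; $\chi^\rho$ is the character of $\rho$. The Plancherel measure is the probability measure on $\mathrm{Irr}(G)$ with $\pi(\rho)=\dim(\rho)^2/|G|$. $g^G$ is the conjugacy class of $g$ in $G$. $\mathrm{Ind}_H^G(1)$ is the class function on $G$ induced from the trivial character of $H$ (the permutation character of $G$ on the cosets of $H$), $\mathrm{Ind}_H^G(1)[g]$ is its value at $g$, and $(\mathrm{Ind}_H^G(1))^r$ is its pointwise $r$-th power (the character of the $r$-fold tensor power). The inner product of class functions is $\langle f_1,f_2\rangle=\frac{1}{|G|}\sum_{g\in G}\overline{f_1(g)}f_2(g)$. *)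

theory Defs
  imports Complex_Main "HOL-Algebra.Coset" "Jordan_Normal_Form.VS_Connect"
begin

section \<open>Complex representations of a group\<close>

text \<open>
  Representations are taken in coordinates: a representation of degree \<open>n\<close> is a group homomorphism
  into \<open>GL\<^sub>n(\<complex>)\<close>. Every finite-dimensional complex representation is isomorphic to one of this
  form, and irreducible representations of a finite group are finite-dimensional.
\<close>

definition GL :: "nat \<Rightarrow> complex mat monoid" where
  "GL n = units_of (ring_mat TYPE(complex) n ())"

definition representation :: "('a, 'b) monoid_scheme \<Rightarrow> nat \<Rightarrow> ('a \<Rightarrow> complex mat) \<Rightarrow> bool" where
  "representation G n \<rho> \<longleftrightarrow> \<rho> \<in> hom G (GL n)"

definition irreducible_rep :: "('a, 'b) monoid_scheme \<Rightarrow> nat \<Rightarrow> ('a \<Rightarrow> complex mat) \<Rightarrow> bool" where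
  "irreducible_rep G n \<rho> \<longleftrightarrow> representation G n \<rho> \<and> n > 0 \<and>
     (\<forall>W. VectorSpace.subspace class_ring W (module_vec TYPE(complex) n) \<longrightarrow>
          (\<forall>g\<in>carrier G. \<forall>v\<in>W. \<rho> g *\<^sub>v v \<in> W) \<longrightarrow>
          W = {0\<^sub>v n} \<or> W = carrier_vec n)"

definition irr_reps :: "('a, 'b) monoid_scheme \<Rightarrow> (nat \<times> ('a \<Rightarrow> complex mat)) set" where
  "irr_reps G = {(n, \<rho>). irreducible_rep G n \<rho>}"

text \<open>
  Isomorphism of irreducible representations: an invertible intertwining operator. Only the values
  on \<open>carrier G\<close> matter, so two functions differing off the carrier are identified.
\<close>

definition rep_iso ::
    "('a, 'b) monoid_scheme \<Rightarrow>
     ((nat \<times> ('a \<Rightarrow> complex mat)) \<times> (nat \<times> ('a \<Rightarrow> complex mat))) set" where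
  "rep_iso G = {((n, \<rho>), (m, \<sigma>)). (n, \<rho>) \<in> irr_reps G \<and> (m, \<sigma>) \<in> irr_reps G \<and> n = m \<and>
     (\<exists>P\<in>carrier (GL n). \<forall>g\<in>carrier G. P * \<rho> g = \<sigma> g * P)}"

definition Irr :: "('a, 'b) monoid_scheme \<Rightarrow> (nat \<times> ('a \<Rightarrow> complex mat)) set set" where
  "Irr G = irr_reps G // rep_iso G"

definition mat_trace :: "complex mat \<Rightarrow> complex" where
  "mat_trace A = (\<Sum>i<dim_row A. A $$ (i, i))"

definition character :: "('a \<Rightarrow> complex mat) \<Rightarrow> 'a \<Rightarrow> complex" where
  "character \<rho> g = mat_trace (\<rho> g)"

text \<open>
  Dimension and character of an isomorphism class are the common values over its members; see
  \<open>irr_dim_eq\<close> and \<open>irr_char_eq\<close> below.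
\<close>

definition irr_dim :: "(nat \<times> ('a \<Rightarrow> complex mat)) set \<Rightarrow> nat" where
  "irr_dim C = the_elem (fst ` C)"

definition irr_char :: "(nat \<times> ('a \<Rightarrow> complex mat)) set \<Rightarrow> 'a \<Rightarrow> complex" where
  "irr_char C g = the_elem ((\<lambda>(n, \<rho>). character \<rho> g) ` C)"

definition plancherel ::
    "('a, 'b) monoid_scheme \<Rightarrow> (nat \<times> ('a \<Rightarrow> complex mat)) set \<Rightarrow> real" where
  "plancherel G C = real (irr_dim C) ^ 2 / real (Coset.order G)"

section \<open>Class functions\<close>

definition class_inner :: "('a, 'b) monoid_scheme \<Rightarrow> ('a \<Rightarrow> complex) \<Rightarrow> ('a \<Rightarrow> complex) \<Rightarrow> complex" where
  "class_inner G f1 f2 = (1 / of_nat (Coset.order G)) * (\<Sum>g\<in>carrier G. cnj (f1 g) * f2 g)"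

definition conj_class :: "('a, 'b) monoid_scheme \<Rightarrow> 'a \<Rightarrow> 'a set" where
  "conj_class G g = {x \<otimes>\<^bsub>G\<^esub> g \<otimes>\<^bsub>G\<^esub> inv\<^bsub>G\<^esub> x | x. x \<in> carrier G}"

text \<open>
  Induction of a class function \<open>f\<close> from the subgroup \<open>H\<close> (finite case):
  \<open>1/|H|\<close> times the sum of \<open>f (x\<inverse> g x)\<close> over all \<open>x\<close> in \<open>G\<close> with \<open>x\<inverse> g x\<close> in \<open>H\<close>.
\<close>

definition Ind :: "('a, 'b) monoid_scheme \<Rightarrow> 'a set \<Rightarrow> ('a \<Rightarrow> complex) \<Rightarrow> 'a \<Rightarrow> complex" where
  "Ind G H f g = (1 / of_nat (card H)) *
     (\<Sum>x | x \<in> carrier G \<and> inv\<^bsub>G\<^esub> x \<otimes>\<^bsub>G\<^esub> g \<otimes>\<^bsub>G\<^esub> x \<in> H. f (inv\<^bsub>G\<^esub> x \<otimes>\<^bsub>G\<^esub> g \<otimes>\<^bsub>G\<^esub> x))"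

abbreviation Ind_one :: "('a, 'b) monoid_scheme \<Rightarrow> 'a set \<Rightarrow> 'a \<Rightarrow> complex" where
  "Ind_one G H \<equiv> Ind G H (\<lambda>_. 1)"

section \<open>Well-definedness on isomorphism classes\<close>

lemma GL_carrier:
  "P \<in> carrier (GL n) \<longleftrightarrow>
     P \<in> carrier_mat n n \<and> (\<exists>Q\<in>carrier_mat n n. Q * P = 1\<^sub>m n \<and> P * Q = 1\<^sub>m n)"
  by (auto simp: GL_def units_of_carrier Units_def ring_mat_def)

lemma rep_carrier:
  assumes "(n, \<rho>) \<in> irr_reps G" "g \<in> carrier G"
  shows "\<rho> g \<in> carrier_mat n n"
  using assms GL_carrier
  by (auto simp: irr_reps_def irreducible_rep_def representation_def hom_def)

lemma mat_trace_comm: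
  assumes A: "A \<in> carrier_mat n n" and B: "B \<in> carrier_mat n n"
  shows "mat_trace (A * B) = mat_trace (B * A)"
proof -
  have "mat_trace (A * B) = (\<Sum>i<n. \<Sum>j<n. A $$ (i, j) * B $$ (j, i))"
    using A B by (auto simp: mat_trace_def scalar_prod_def lessThan_atLeast0 intro!: sum.cong)
  also have "\<dots> = (\<Sum>j<n. \<Sum>i<n. B $$ (j, i) * A $$ (i, j))"
    by (subst sum.swap) (simp add: mult.commute)
  also have "\<dots> = mat_trace (B * A)"
    using A B by (auto simp: mat_trace_def scalar_prod_def lessThan_atLeast0 intro!: sum.cong)
  finally show ?thesis .
qed

lemma rep_isoI:
  assumes "(n, \<rho>) \<in> irr_reps G" "(n, \<sigma>) \<in> irr_reps G"
    and "P \<in> carrier_mat n n" "Q \<in> carrier_mat n n" "Q * P = 1\<^sub>m n" "P * Q = 1\<^sub>m n"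
    and "\<And>g. g \<in> carrier G \<Longrightarrow> P * \<rho> g = \<sigma> g * P"
  shows "((n, \<rho>), (n, \<sigma>)) \<in> rep_iso G"
proof -
  have "P \<in> carrier (GL n)" unfolding GL_carrier using assms(3-6) by blast
  then show ?thesis unfolding rep_iso_def using assms(1,2,7) by blast
qed

lemma rep_isoE:
  assumes "(x, y) \<in> rep_iso G"
  obtains n \<rho> \<sigma> P Q where "x = (n, \<rho>)" "y = (n, \<sigma>)"
    "(n, \<rho>) \<in> irr_reps G" "(n, \<sigma>) \<in> irr_reps G"
    "P \<in> carrier_mat n n" "Q \<in> carrier_mat n n" "Q * P = 1\<^sub>m n" "P * Q = 1\<^sub>m n"
    "\<And>g. g \<in> carrier G \<Longrightarrow> P * \<rho> g = \<sigma> g * P"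
proof -
  obtain n \<rho> m \<sigma> where xy: "x = (n, \<rho>)" "y = (m, \<sigma>)" by (cases x, cases y)
  with assms have "n = m" by (simp add: rep_iso_def)
  with assms xy have irr: "(n, \<rho>) \<in> irr_reps G" "(n, \<sigma>) \<in> irr_reps G"
    and "\<exists>P\<in>carrier (GL n). \<forall>g\<in>carrier G. P * \<rho> g = \<sigma> g * P"
    by (simp_all add: rep_iso_def)
  then obtain P where P: "P \<in> carrier (GL n)" and eq: "\<And>g. g \<in> carrier G \<Longrightarrow> P * \<rho> g = \<sigma> g * P"
    by auto
  from P obtain Q where "P \<in> carrier_mat n n" "Q \<in> carrier_mat n n" "Q * P = 1\<^sub>m n" "P * Q = 1\<^sub>m n"
    unfolding GL_carrier by auto
  from that[OF xy[folded \<open>n = m\<close>] irr this eq] show ?thesis .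
qed

lemma rep_iso_equiv: "equiv (irr_reps G) (rep_iso G)"
proof (rule equivI)
  show "rep_iso G \<subseteq> irr_reps G \<times> irr_reps G"
    by (auto simp: rep_iso_def)
  show "refl_on (irr_reps G) (rep_iso G)"
  proof (rule refl_onI)
    fix x assume x: "x \<in> irr_reps G"
    obtain n \<rho> where n: "x = (n, \<rho>)" by force
    have "1\<^sub>m n * \<rho> g = \<rho> g * 1\<^sub>m n" if "g \<in> carrier G" for g
      using rep_carrier[OF x[unfolded n] that] by simp
    then show "(x, x) \<in> rep_iso G"
      unfolding n using x[unfolded n] by (intro rep_isoI[where P = "1\<^sub>m n" and Q = "1\<^sub>m n"]) simp_all
  qed
  show "sym (rep_iso G)"
  proof (rule symI)
    fix x y assume "(x, y) \<in> rep_iso G"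
    then obtain n \<rho> \<sigma> P Q where xy: "x = (n, \<rho>)" "y = (n, \<sigma>)"
      and irr: "(n, \<rho>) \<in> irr_reps G" "(n, \<sigma>) \<in> irr_reps G"
      and PQ: "P \<in> carrier_mat n n" "Q \<in> carrier_mat n n" and inv: "Q * P = 1\<^sub>m n" "P * Q = 1\<^sub>m n"
      and eq: "\<And>g. g \<in> carrier G \<Longrightarrow> P * \<rho> g = \<sigma> g * P" by (rule rep_isoE) blast
    have "Q * \<sigma> g = \<rho> g * Q" if g: "g \<in> carrier G" for g
    proof -
      note c = rep_carrier[OF irr(1) g] rep_carrier[OF irr(2) g] PQ
      have "Q * \<sigma> g = Q * (\<sigma> g * (P * Q))" unfolding inv(2) using c by simp
      also have "\<sigma> g * (P * Q) = (P * \<rho> g) * Q"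
        unfolding eq[OF g] by (rule assoc_mult_mat[symmetric]) (rule c)+
      also have "\<dots> = P * (\<rho> g * Q)" by (rule assoc_mult_mat) (rule c)+
      also have "Q * \<dots> = (Q * P) * (\<rho> g * Q)"
        by (rule assoc_mult_mat[symmetric]) (rule c mult_carrier_mat)+
      also have "\<dots> = \<rho> g * Q" unfolding inv(1) using c by simp
      finally show ?thesis .
    qed
    then show "(y, x) \<in> rep_iso G" unfolding xy by (rule rep_isoI[OF irr(2,1) PQ(2,1) inv(2,1)])
  qed
  show "trans (rep_iso G)"
  proof (rule transI)
    fix x y z assume xy: "(x, y) \<in> rep_iso G" and yz: "(y, z) \<in> rep_iso G"
    from xy obtain n \<rho> \<sigma> P Q where xy: "x = (n, \<rho>)" "y = (n, \<sigma>)"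
      and irr: "(n, \<rho>) \<in> irr_reps G" "(n, \<sigma>) \<in> irr_reps G"
      and PQ: "P \<in> carrier_mat n n" "Q \<in> carrier_mat n n" and inv: "Q * P = 1\<^sub>m n" "P * Q = 1\<^sub>m n"
      and eq: "\<And>g. g \<in> carrier G \<Longrightarrow> P * \<rho> g = \<sigma> g * P" by (rule rep_isoE) blast
    from yz xy(2) obtain \<tau> R S where z: "z = (n, \<tau>)" and irr': "(n, \<tau>) \<in> irr_reps G"
      and RS: "R \<in> carrier_mat n n" "S \<in> carrier_mat n n" and inv': "S * R = 1\<^sub>m n" "R * S = 1\<^sub>m n"
      and eq': "\<And>g. g \<in> carrier G \<Longrightarrow> R * \<sigma> g = \<tau> g * R" by (elim rep_isoE) blast
    have cancel: "(A * B) * (C * D) = 1\<^sub>m n"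
      if "A \<in> carrier_mat n n" "B \<in> carrier_mat n n" "C \<in> carrier_mat n n" "D \<in> carrier_mat n n"
        "B * C = 1\<^sub>m n" "A * D = 1\<^sub>m n" for A B C D :: "complex mat"
    proof -
      have "(A * B) * (C * D) = A * (B * (C * D))"
        by (rule assoc_mult_mat) (rule that mult_carrier_mat)+
      also have "B * (C * D) = (B * C) * D" by (rule assoc_mult_mat[symmetric]) (rule that)+
      also have "A * \<dots> = 1\<^sub>m n" unfolding that(5) using that(4,6) by simp
      finally show ?thesis .
    qed
    show "(x, z) \<in> rep_iso G" unfolding xy z
    proof (rule rep_isoI[OF irr(1) irr'])
      show "R * P \<in> carrier_mat n n" "Q * S \<in> carrier_mat n n" using PQ RS by auto
      show "(Q * S) * (R * P) = 1\<^sub>m n" using PQ RS inv inv' by (intro cancel)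
      show "(R * P) * (Q * S) = 1\<^sub>m n" using PQ RS inv inv' by (intro cancel)
      fix g assume g: "g \<in> carrier G"
      note c = rep_carrier[OF irr(1) g] rep_carrier[OF irr(2) g] rep_carrier[OF irr' g] PQ RS
      have "(R * P) * \<rho> g = R * (P * \<rho> g)" by (rule assoc_mult_mat) (rule c)+
      also have "\<dots> = R * (\<sigma> g * P)" by (simp only: eq[OF g])
      also have "\<dots> = (R * \<sigma> g) * P" by (rule assoc_mult_mat[symmetric]) (rule c)+
      also have "\<dots> = (\<tau> g * R) * P" by (simp only: eq'[OF g])
      also have "\<dots> = \<tau> g * (R * P)" by (rule assoc_mult_mat) (rule c)+
      finally show "(R * P) * \<rho> g = \<tau> g * (R * P)" .
    qed
  qed
qed

lemma rep_iso_character: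
  assumes "((n, \<rho>), (m, \<sigma>)) \<in> rep_iso G" and g: "g \<in> carrier G"
  shows "character \<rho> g = character \<sigma> g"
proof -
  from assms(1) obtain P Q where irr: "(n, \<rho>) \<in> irr_reps G" "(n, \<sigma>) \<in> irr_reps G"
    and PQ: "P \<in> carrier_mat n n" "Q \<in> carrier_mat n n" and inv: "Q * P = 1\<^sub>m n" "P * Q = 1\<^sub>m n"
    and eq: "P * \<rho> g = \<sigma> g * P" using g by (elim rep_isoE) blast
  note c = rep_carrier[OF irr(1) g] rep_carrier[OF irr(2) g] PQ
  have "\<rho> g = (Q * P) * \<rho> g" unfolding inv(1) using c by simp
  also have "\<dots> = Q * (P * \<rho> g)" by (rule assoc_mult_mat) (rule c)+
  finally have "mat_trace (\<rho> g) = mat_trace (Q * (\<sigma> g * P))" unfolding eq by (rule arg_cong)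
  also have "\<dots> = mat_trace ((\<sigma> g * P) * Q)"
    by (rule mat_trace_comm) (rule c mult_carrier_mat)+
  also have "(\<sigma> g * P) * Q = \<sigma> g * (P * Q)" by (rule assoc_mult_mat) (rule c)+
  also have "\<dots> = \<sigma> g" unfolding inv(2) using c by simp
  finally show ?thesis by (simp add: character_def)
qed

lemma irr_class_related:
  assumes "C \<in> Irr G" "x \<in> C" "y \<in> C"
  shows "(x, y) \<in> rep_iso G"
  using quotient_eq_iff[OF rep_iso_equiv assms(1)[unfolded Irr_def] assms(1)[unfolded Irr_def] assms(2,3)]
  by simp

lemma irr_dim_eq:
  assumes "C \<in> Irr G" "(n, \<rho>) \<in> C"
  shows "irr_dim C = n"
proof -
  have "fst y = n" if "y \<in> C" for y
    using irr_class_related[OF assms that] by (cases y) (simp add: rep_iso_def)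
  then have "fst ` C = (\<lambda>_. n) ` C" by (rule image_cong[OF refl])
  also have "\<dots> = {n}" using assms(2) by (rule image_constant)
  finally show ?thesis by (simp add: irr_dim_def)
qed

lemma irr_char_eq:
  assumes "C \<in> Irr G" "(n, \<rho>) \<in> C" "g \<in> carrier G"
  shows "irr_char C g = character \<rho> g"
proof -
  have "character \<sigma> g = character \<rho> g" if "(m, \<sigma>) \<in> C" for m \<sigma>
    by (rule rep_iso_character[OF irr_class_related[OF assms(1) that assms(2)] assms(3)])
  then have "(\<lambda>(n, \<rho>). character \<rho> g) y = character \<rho> g" if "y \<in> C" for y
    using that by (cases y) simp
  then have "(\<lambda>(n, \<rho>). character \<rho> g) ` C = (\<lambda>_. character \<rho> g) ` C"
    by (rule image_cong[OF refl])
  also have "\<dots> = {character \<rho> g}" using assms(2) by (rule image_constant)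
  finally show ?thesis by (simp add: irr_char_def)
qed

end

theory Submission
  imports Defs "Jordan_Normal_Form.Spectral_Radius" "HOL-Analysis.L2_Norm"
begin

text \<open>
  Put \<open>f(g) = (|H|/|G| Ind(g))\<^sup>r\<close>. Counting the elements that conjugate \<open>g\<close> into \<open>H\<close> shows that the
  number \<open>|H|/|G| Ind(g)\<close> is the proportion of the conjugacy class of \<open>g\<close> lying in \<open>H\<close>
  (\<open>Ind_one_fixed_ratio\<close>). This is the equality of the two formulas for \<open>\<beta>\<close>, and it gives \<open>f(1) = 1\<close>
  and \<open>0 \<le> f(g) \<le> \<beta>\<^sup>r\<close> for \<open>g \<noteq> 1\<close>.

  In \<open>dim(\<rho>) \<langle>\<chi>\<^sup>\<rho>, f\<rangle>\<close> the term \<open>g = 1\<close> equals \<open>dim(\<rho>)\<^sup>2/|G| = \<pi>(\<rho>)\<close>. What has to be bounded is therefore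
  \<open>\<Sum>\<rho>. dim(\<rho>) |\<langle>\<chi>\<^sup>\<rho>, f'\<rangle>|\<close>, where \<open>f'\<close> is \<open>f\<close> with its value at \<open>1\<close> replaced by \<open>0\<close>. By the
  Cauchy-Schwarz inequality it is at most the product of \<open>(\<Sum>\<rho>. dim(\<rho>)\<^sup>2)\<^sup>1\<^sup>/\<^sup>2\<close> and
  \<open>(\<Sum>\<rho>. |\<langle>\<chi>\<^sup>\<rho>, f'\<rangle>|\<^sup>2)\<^sup>1\<^sup>/\<^sup>2\<close>. Both factors are controlled by Bessel's inequality
  (\<open>bessel_class_inner\<close>) for the orthonormal family of irreducible characters: the first by applying it
  to the indicator of the identity (\<open>sum_irr_dim_square_le\<close>), the second by applying it to \<open>f'\<close>
  (\<open>plancherel_distance_le\<close>).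

  Orthonormality (\<open>irr_char_orthonormal\<close>) comes from Schur's lemma in the usual way: averaging a
  matrix unit over the group yields an intertwiner. The representations are not assumed unitary, so
  the identity \<open>cnj \<chi>(g) = \<chi>(g\<inverse>)\<close>, which turns the Hermitian inner product of characters into sums
  of products of matrix coefficients, is derived from an invariant Hermitian form
  (\<open>character_cnj\<close>).
\<close>

section \<open>Representations in coordinates\<close>

lemma scalar_prod_lessThan:
  "dim_vec w = n \<Longrightarrow> v \<bullet> w = (\<Sum>i<n. v $ i * w $ i)"
  by (simp add: scalar_prod_def lessThan_atLeast0)

lemma mult_mat_entry:
  assumes "A \<in> carrier_mat n m" "B \<in> carrier_mat m k" "i < n" "j < k"
  shows "(A * B) $$ (i, j) = (\<Sum>p<m. A $$ (i, p) * B $$ (p, j))"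
  using assms by (simp add: scalar_prod_lessThan)

lemma mat_trace_mult:
  assumes "A \<in> carrier_mat n m" "B \<in> carrier_mat m n"
  shows "mat_trace (A * B) = (\<Sum>i<n. \<Sum>p<m. A $$ (i, p) * B $$ (p, i))"
  using assms by (simp add: mat_trace_def scalar_prod_lessThan)

lemma mat_trace_comm_rect:
  assumes "A \<in> carrier_mat n m" "B \<in> carrier_mat m n"
  shows "mat_trace (A * B) = mat_trace (B * A)"
  unfolding mat_trace_mult[OF assms] mat_trace_mult[OF assms(2,1)]
  by (subst sum.swap) (simp add: mult.commute)

lemma mat_trace_one: "mat_trace (1\<^sub>m n) = of_nat n"
  by (simp add: mat_trace_def)

lemma mat_eq_zeroI:
  fixes T :: "complex mat"
  assumes T: "T \<in> carrier_mat n m" and unit: "\<And>j. T *\<^sub>v unit_vec m j = 0\<^sub>v n"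
  shows "T = 0\<^sub>m n m"
proof (rule eq_matI)
  fix i j assume "i < dim_row (0\<^sub>m n m)" "j < dim_col (0\<^sub>m n m)"
  then show "T $$ (i, j) = 0\<^sub>m n m $$ (i, j)"
    using arg_cong[OF unit[of j], of "\<lambda>v. v $ i"] T by simp
qed (use T in auto)

lemma subspace_module_vecI:
  assumes "W \<subseteq> carrier_vec n" "0\<^sub>v n \<in> W"
    and "\<And>v w. v \<in> W \<Longrightarrow> w \<in> W \<Longrightarrow> v + w \<in> W"
    and "\<And>c v. v \<in> W \<Longrightarrow> c \<cdot>\<^sub>v v \<in> W"
  shows "VectorSpace.subspace class_ring W (module_vec TYPE(complex) n)"
proof -
  interpret vec_space "TYPE(complex)" n .
  show ?thesis
    using assms by (auto simp: VectorSpace.subspace_def submodule_def module_vec_simps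
        intro: vectorspace_axioms module_axioms)
qed

lemma irreducible_rep_invariant_subspace:
  assumes "irreducible_rep G n \<rho>"
    and "W \<subseteq> carrier_vec n" "0\<^sub>v n \<in> W"
    and "\<And>v w. v \<in> W \<Longrightarrow> w \<in> W \<Longrightarrow> v + w \<in> W"
    and "\<And>c v. v \<in> W \<Longrightarrow> c \<cdot>\<^sub>v v \<in> W"
    and "\<And>g v. g \<in> carrier G \<Longrightarrow> v \<in> W \<Longrightarrow> \<rho> g *\<^sub>v v \<in> W"
  shows "W = {0\<^sub>v n} \<or> W = carrier_vec n"
  using assms(1,6) subspace_module_vecI[OF assms(2-5)] unfolding irreducible_rep_def by blast

lemma rep_carrier_mat:
  assumes "representation G n \<rho>" "g \<in> carrier G"
  shows "\<rho> g \<in> carrier_mat n n"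
  using assms GL_carrier by (auto simp: representation_def hom_def)

lemma irreducible_repD:
  assumes "irreducible_rep G n \<rho>"
  shows "representation G n \<rho>" "n > 0"
  using assms by (simp_all add: irreducible_rep_def)

lemma rep_mult:
  assumes "representation G n \<rho>" "g \<in> carrier G" "h \<in> carrier G"
  shows "\<rho> (g \<otimes>\<^bsub>G\<^esub> h) = \<rho> g * \<rho> h"
  using assms by (simp add: representation_def hom_def GL_def units_of_mult ring_mat_simps)

lemma rep_mult_entry:
  assumes "representation G n \<rho>" "g \<in> carrier G" "h \<in> carrier G" "i < n" "j < n"
  shows "\<rho> (g \<otimes>\<^bsub>G\<^esub> h) $$ (i, j) = (\<Sum>p<n. \<rho> g $$ (i, p) * \<rho> h $$ (p, j))"
  unfolding rep_mult[OF assms(1-3)]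
  using rep_carrier_mat[OF assms(1)] assms by (intro mult_mat_entry) auto

lemma rep_one:
  assumes "group G" "representation G n \<rho>"
  shows "\<rho> \<one>\<^bsub>G\<^esub> = 1\<^sub>m n"
proof -
  interpret R: ring "ring_mat TYPE(complex) n ()" by (rule ring_mat)
  have "group (GL n)" unfolding GL_def by (rule R.units_group)
  then show ?thesis
    using hom_one[of \<rho> G "GL n"] assms
    by (simp add: representation_def GL_def units_of_one ring_mat_simps)
qed

lemma character_one:
  assumes "group G" "representation G n \<rho>"
  shows "character \<rho> \<one>\<^bsub>G\<^esub> = of_nat n"
  by (simp add: character_def rep_one[OF assms] mat_trace_one)

section \<open>Schur's lemma\<close>

text \<open>
  The kernel of an intertwiner is an invariant subspace of its source, and it is a proper one when
  the intertwiner is non-zero. Dually, the image in the next lemma is a non-zero invariant subspace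
  of the target.
\<close>

lemma intertwiner_injective:
  fixes T :: "complex mat"
  assumes \<sigma>: "irreducible_rep G m \<sigma>" and \<rho>: "representation G n \<rho>"
    and T: "T \<in> carrier_mat n m" "T \<noteq> 0\<^sub>m n m"
    and comm: "\<And>g. g \<in> carrier G \<Longrightarrow> \<rho> g * T = T * \<sigma> g"
    and v: "v \<in> carrier_vec m" "T *\<^sub>v v = 0\<^sub>v n"
  shows "v = 0\<^sub>v m"
proof -
  let ?K = "{v \<in> carrier_vec m. T *\<^sub>v v = 0\<^sub>v n}"
  have "?K = {0\<^sub>v m} \<or> ?K = carrier_vec m"
  proof (rule irreducible_rep_invariant_subspace[OF \<sigma>])
    fix g v assume g: "g \<in> carrier G" and v: "v \<in> ?K"
    note c = rep_carrier_mat[OF \<rho> g] rep_carrier_mat[OF irreducible_repD(1)[OF \<sigma>] g] T(1)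
    have "T *\<^sub>v (\<sigma> g *\<^sub>v v) = (T * \<sigma> g) *\<^sub>v v"
      using c v by (intro assoc_mult_mat_vec[symmetric]) auto
    also have "\<dots> = \<rho> g *\<^sub>v (T *\<^sub>v v)"
      unfolding comm[OF g, symmetric] using c v by (intro assoc_mult_mat_vec) auto
    also have "\<dots> = 0\<^sub>v n"
    proof -
      have "\<rho> g *\<^sub>v 0\<^sub>v n = 0\<^sub>v n" using c(1) by (intro eq_vecI) auto
      with v show ?thesis by simp
    qed
    finally show "\<sigma> g *\<^sub>v v \<in> ?K" using c v by auto
  next
    fix v w assume "v \<in> ?K" "w \<in> ?K"
    then show "v + w \<in> ?K" using T(1) by (simp add: mult_add_distrib_mat_vec)
  next
    fix c :: complex and v assume "v \<in> ?K"
    moreover have "c \<cdot>\<^sub>v 0\<^sub>v n = 0\<^sub>v n" by (intro eq_vecI) auto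
    ultimately show "c \<cdot>\<^sub>v v \<in> ?K" using T(1) by (simp add: mult_mat_vec)
  next
    show "0\<^sub>v m \<in> ?K" using T(1) by (auto intro!: eq_vecI)
  qed auto
  moreover have "?K \<noteq> carrier_vec m"
  proof
    assume "?K = carrier_vec m"
    then have *: "T *\<^sub>v unit_vec m j = 0\<^sub>v n" for j
      using unit_vec_carrier by blast
    with mat_eq_zeroI[OF T(1)] T(2) show False by blast
  qed
  ultimately have "?K = {0\<^sub>v m}" by blast
  with v show ?thesis by blast
qed

lemma intertwiner_surjective:
  fixes T :: "complex mat"
  assumes \<rho>: "irreducible_rep G n \<rho>" and \<sigma>: "representation G m \<sigma>"
    and T: "T \<in> carrier_mat n m" "T \<noteq> 0\<^sub>m n m"
    and comm: "\<And>g. g \<in> carrier G \<Longrightarrow> \<rho> g * T = T * \<sigma> g"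
    and w: "w \<in> carrier_vec n"
  shows "\<exists>v\<in>carrier_vec m. T *\<^sub>v v = w"
proof -
  let ?I = "(\<lambda>v. T *\<^sub>v v) ` carrier_vec m"
  have "?I = {0\<^sub>v n} \<or> ?I = carrier_vec n"
  proof (rule irreducible_rep_invariant_subspace[OF \<rho>])
    show "0\<^sub>v n \<in> ?I" using T by (intro image_eqI[of _ _ "0\<^sub>v m"]) auto
  next
    fix x y assume "x \<in> ?I" "y \<in> ?I"
    then obtain v w where "x = T *\<^sub>v v" "y = T *\<^sub>v w" "v \<in> carrier_vec m" "w \<in> carrier_vec m" by auto
    with T show "x + y \<in> ?I"
      by (intro image_eqI[of _ _ "v + w"]) (auto simp: mult_add_distrib_mat_vec)
  next
    fix c x assume "x \<in> ?I"
    then obtain v where "x = T *\<^sub>v v" "v \<in> carrier_vec m" by auto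
    with T show "c \<cdot>\<^sub>v x \<in> ?I"
      by (intro image_eqI[of _ _ "c \<cdot>\<^sub>v v"]) (auto simp: mult_mat_vec)
  next
    fix g x assume g: "g \<in> carrier G" and "x \<in> ?I"
    then obtain v where x: "x = T *\<^sub>v v" and v: "v \<in> carrier_vec m" by auto
    note c = rep_carrier_mat[OF irreducible_repD(1)[OF \<rho>] g] rep_carrier_mat[OF \<sigma> g] T(1)
    have "\<rho> g *\<^sub>v x = (\<rho> g * T) *\<^sub>v v"
      unfolding x using c v by (intro assoc_mult_mat_vec[symmetric]) auto
    also have "\<dots> = T *\<^sub>v (\<sigma> g *\<^sub>v v)"
      unfolding comm[OF g] using c v by (intro assoc_mult_mat_vec) auto
    finally show "\<rho> g *\<^sub>v x \<in> ?I" using c v by auto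
  qed (use T in auto)
  moreover have "?I \<noteq> {0\<^sub>v n}"
  proof
    assume I: "?I = {0\<^sub>v n}"
    have *: "T *\<^sub>v unit_vec m j = 0\<^sub>v n" for j using I by (metis image_eqI singletonD unit_vec_carrier)
    with mat_eq_zeroI[OF T(1)] T(2) show False by blast
  qed
  ultimately have "?I = carrier_vec n" by blast
  with w show ?thesis by (metis imageE)
qed

text \<open>
  A non-zero intertwiner has a right inverse by surjectivity, and injectivity makes the right inverse
  two-sided. Equality of the degrees is read off from traces: \<open>n = tr (T Q) = tr (Q T) = m\<close>.
\<close>

theorem schur_iso:
  fixes T :: "complex mat"
  assumes \<rho>: "irreducible_rep G n \<rho>" and \<sigma>: "irreducible_rep G m \<sigma>"
    and T: "T \<in> carrier_mat n m" "T \<noteq> 0\<^sub>m n m"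
    and comm: "\<And>g. g \<in> carrier G \<Longrightarrow> \<rho> g * T = T * \<sigma> g"
  shows "((m, \<sigma>), (n, \<rho>)) \<in> rep_iso G"
proof -
  have "\<exists>u\<in>carrier_vec m. T *\<^sub>v u = unit_vec n i" for i
    using intertwiner_surjective[OF \<rho> irreducible_repD(1)[OF \<sigma>] T comm] by simp
  then obtain u where u: "\<And>i. u i \<in> carrier_vec m" "\<And>i. T *\<^sub>v u i = unit_vec n i" by metis
  \<comment> \<open>The columns of the right inverse are preimages of the unit vectors.\<close>
  define Q where "Q = mat m n (\<lambda>(k, i). u i $ k)"
  have Q: "Q \<in> carrier_mat m n" by (simp add: Q_def)
  have "col Q i = u i" if "i < n" for i
    using u(1)[of i] that by (intro eq_vecI) (auto simp: Q_def)
  then have "col (T * Q) i = unit_vec n i" if "i < n" for i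
    using that by (simp only: col_mult2[OF T(1) Q that] u(2))
  then have TQ: "T * Q = 1\<^sub>m n"
    using T Q by (intro mat_col_eqI) auto
  have QT: "Q * T = 1\<^sub>m m"
  proof -
    \<comment> \<open>\<open>T\<close> annihilates \<open>Q T - 1\<close>, since \<open>T Q T = T\<close>, and \<open>T\<close> is injective.\<close>
    let ?D = "Q * T - 1\<^sub>m m"
    have D: "?D \<in> carrier_mat m m" using Q T by auto
    have "T * ?D = T * (Q * T) - T * 1\<^sub>m m"
      using Q T by (intro mult_minus_distrib_mat) auto
    also have "T * (Q * T) = (T * Q) * T" using Q T by (intro assoc_mult_mat[symmetric])
    finally have TD: "T * ?D = 0\<^sub>m n m" using T by (simp add: TQ)
    have "col ?D j = 0\<^sub>v m" if "j < m" for j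
    proof (rule intertwiner_injective[OF \<sigma> irreducible_repD(1)[OF \<rho>] T comm])
      show "T *\<^sub>v col ?D j = 0\<^sub>v n"
        using col_mult2[OF T(1) D that] TD that by simp
    qed (use D that in auto)
    then have "?D = 0\<^sub>m m m" using D by (intro mat_col_eqI) auto
    then have "Q * T - 1\<^sub>m m + 1\<^sub>m m = 0\<^sub>m m m + 1\<^sub>m m" by simp
    then show ?thesis using Q T by (auto simp: mat_eq_iff)
  qed
  have "of_nat n = mat_trace (T * Q)" by (simp add: TQ mat_trace_one)
  also have "\<dots> = mat_trace (Q * T)" by (rule mat_trace_comm_rect[OF T(1) Q])
  also have "\<dots> = of_nat m" by (simp add: QT mat_trace_one)
  finally have "n = m" by simp
  have "((n, \<sigma>), (n, \<rho>)) \<in> rep_iso G"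
  proof (rule rep_isoI)
    show "(n, \<sigma>) \<in> irr_reps G" "(n, \<rho>) \<in> irr_reps G"
      using \<rho> \<sigma> by (simp_all add: irr_reps_def \<open>n = m\<close>)
    show "T \<in> carrier_mat n n" "Q \<in> carrier_mat n n" "Q * T = 1\<^sub>m n" "T * Q = 1\<^sub>m n"
      using T Q TQ QT by (simp_all add: \<open>n = m\<close>)
  qed (simp add: comm)
  then show ?thesis by (simp add: \<open>n = m\<close>)
qed

text \<open>
  Over the complex numbers \<open>T\<close> has an eigenvalue \<open>c\<close>. The intertwiner \<open>T - c\<close> kills an eigenvector,
  so it is not injective and must vanish.
\<close>

theorem schur_scalar:
  fixes T :: "complex mat"
  assumes \<rho>: "irreducible_rep G n \<rho>"
    and T: "T \<in> carrier_mat n n"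
    and comm: "\<And>g. g \<in> carrier G \<Longrightarrow> \<rho> g * T = T * \<rho> g"
  obtains c where "T = c \<cdot>\<^sub>m 1\<^sub>m n"
proof -
  from spectrum_non_empty[OF T irreducible_repD(2)[OF \<rho>]]
  obtain c v where v: "v \<in> carrier_vec n" "v \<noteq> 0\<^sub>v n" "T *\<^sub>v v = c \<cdot>\<^sub>v v"
    using T by (auto simp: spectrum_def eigenvalue_def eigenvector_def)
  define S where "S = T - c \<cdot>\<^sub>m 1\<^sub>m n"
  have S: "S \<in> carrier_mat n n" using T by (auto simp: S_def)
  have "S = 0\<^sub>m n n"
  proof (rule ccontr)
    assume "S \<noteq> 0\<^sub>m n n"
    moreover have "\<rho> g * S = S * \<rho> g" if g: "g \<in> carrier G" for g
    proof -
      note c = rep_carrier_mat[OF irreducible_repD(1)[OF \<rho>] g]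
      have "\<rho> g * (c \<cdot>\<^sub>m 1\<^sub>m n) = c \<cdot>\<^sub>m 1\<^sub>m n * \<rho> g"
        using c by (simp add: mult_smult_distrib[OF c one_carrier_mat] mult_smult_assoc_mat[OF one_carrier_mat c])
      then show ?thesis
        unfolding S_def using c T comm[OF g]
        by (simp add: mult_minus_distrib_mat minus_mult_distrib_mat)
    qed
    moreover have "S *\<^sub>v v = 0\<^sub>v n"
    proof -
      have "c \<cdot>\<^sub>m 1\<^sub>m n *\<^sub>v v = c \<cdot>\<^sub>v v" using v(1) by (intro eq_vecI) auto
      then show ?thesis
        unfolding S_def using T v by (simp add: minus_mult_distrib_mat_vec)
    qed
    ultimately have "v = 0\<^sub>v n"
      using intertwiner_injective[OF \<rho> irreducible_repD(1)[OF \<rho>] S _ _ v(1)] by blast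
    with v show False by simp
  qed
  then have "T = c \<cdot>\<^sub>m 1\<^sub>m n" using T unfolding S_def by (auto simp: mat_eq_iff)
  then show ?thesis by (rule that)
qed

section \<open>Orthogonality of irreducible characters\<close>

lemma sum_swap3:
  "(\<Sum>a\<in>A. \<Sum>b\<in>B. \<Sum>c\<in>C. f a b c) = (\<Sum>b\<in>B. \<Sum>c\<in>C. \<Sum>a\<in>A. f a b c)"
  by (subst sum.swap, rule sum.cong[OF refl], rule sum.swap)

lemma sum_swap_pairs:
  "(\<Sum>k\<in>K. \<Sum>l\<in>L. \<Sum>g\<in>A. \<Sum>p\<in>B. f k l g p)
     = (\<Sum>g\<in>A. \<Sum>p\<in>B. \<Sum>k\<in>K. \<Sum>l\<in>L. f k l g p)"
  by (subst sum_swap3[symmetric], rule sum.cong[OF refl], rule sum_swap3)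

text \<open>
  For the matrix unit \<open>E\<^sub>i\<^sub>j\<close>, the matrix \<open>T\<close> is the group average \<open>\<Sum>g. \<rho>(g\<inverse>) E\<^sub>i\<^sub>j \<sigma>(g)\<close>, and substituting
  \<open>g \<mapsto> g h\<close> in the sum makes it an intertwiner. Applying Schur's lemma to it, and comparing
  entries, gives the orthogonality relations of the matrix coefficients.
\<close>

lemma (in group) rep_averaging_comm:
  assumes \<rho>: "representation G n \<rho>" and \<sigma>: "representation G m \<sigma>"
    and ij: "i < n" "j < m" and h: "h \<in> carrier G"
  defines "T \<equiv> mat n m (\<lambda>(k, l). \<Sum>g\<in>carrier G. \<rho> (inv g) $$ (k, i) * \<sigma> g $$ (j, l))"
  shows "\<rho> h * T = T * \<sigma> h"
proof (rule eq_matI)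
  note c = rep_carrier_mat[OF \<rho> h] rep_carrier_mat[OF \<sigma> h]
  have T: "T \<in> carrier_mat n m" by (simp add: T_def)
  fix k l assume "k < dim_row (T * \<sigma> h)" "l < dim_col (T * \<sigma> h)"
  then have kl: "k < n" "l < m" using T c by auto
  have "(\<rho> h * T) $$ (k, l)
      = (\<Sum>p<n. \<Sum>g\<in>carrier G. \<rho> h $$ (k, p) * \<rho> (inv g) $$ (p, i) * \<sigma> g $$ (j, l))"
    unfolding mult_mat_entry[OF c(1) T kl] using kl
    by (auto simp: T_def sum_distrib_left mult.assoc intro!: sum.cong)
  also have "\<dots> = (\<Sum>g\<in>carrier G. \<rho> (h \<otimes> inv g) $$ (k, i) * \<sigma> g $$ (j, l))"
    by (subst sum.swap) (use kl ij h in \<open>auto simp: rep_mult_entry[OF \<rho>] sum_distrib_right intro!: sum.cong\<close>)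
  also have "\<dots> = (\<Sum>g\<in>carrier G. \<rho> (inv g) $$ (k, i) * \<sigma> (g \<otimes> h) $$ (j, l))"
    using h by (intro sum.reindex_bij_witness[of _ "\<lambda>g. g \<otimes> h" "\<lambda>g. g \<otimes> inv h"])
      (auto simp: m_assoc inv_mult_group)
  also have "\<dots> = (\<Sum>g\<in>carrier G. \<Sum>q<m. \<rho> (inv g) $$ (k, i) * (\<sigma> g $$ (j, q) * \<sigma> h $$ (q, l)))"
    using kl ij h by (auto simp: rep_mult_entry[OF \<sigma>] sum_distrib_left intro!: sum.cong)
  also have "\<dots> = (T * \<sigma> h) $$ (k, l)"
    unfolding mult_mat_entry[OF T c(2) kl] using kl
    by (subst sum.swap) (auto simp: T_def sum_distrib_right mult.assoc intro!: sum.cong)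
  finally show "(\<rho> h * T) $$ (k, l) = (T * \<sigma> h) $$ (k, l)" .
qed (use rep_carrier_mat[OF \<rho> h] rep_carrier_mat[OF \<sigma> h] in \<open>auto simp: T_def\<close>)

lemma (in group) matrix_coefficients_orthogonal:
  assumes \<rho>: "irreducible_rep G n \<rho>" and \<sigma>: "irreducible_rep G m \<sigma>"
    and noniso: "((m, \<sigma>), (n, \<rho>)) \<notin> rep_iso G"
    and ij: "i < n" "j < m" "k < n" "l < m"
  shows "(\<Sum>g\<in>carrier G. \<rho> (inv g) $$ (k, i) * \<sigma> g $$ (j, l)) = 0"
proof -
  define T where
    "T = mat n m (\<lambda>(k, l). \<Sum>g\<in>carrier G. \<rho> (inv g) $$ (k, i) * \<sigma> g $$ (j, l))"
  have "T = 0\<^sub>m n m"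
  proof (rule ccontr)
    assume T: "T \<noteq> 0\<^sub>m n m"
    have "((m, \<sigma>), (n, \<rho>)) \<in> rep_iso G"
    proof (rule schur_iso[OF \<rho> \<sigma> _ T])
      fix h assume "h \<in> carrier G"
      then show "\<rho> h * T = T * \<sigma> h"
        unfolding T_def
        using rep_averaging_comm[OF irreducible_repD(1)[OF \<rho>] irreducible_repD(1)[OF \<sigma>]] ij
        by blast
    qed (simp add: T_def)
    with noniso show False ..
  qed
  from arg_cong[OF this, of "\<lambda>T. T $$ (k, l)"] show ?thesis using ij by (simp add: T_def)
qed

text \<open>
  Here Schur's lemma makes the average a scalar \<open>c\<close>. Its trace is \<open>n c\<close>, and it is also
  \<open>\<Sum>g. (\<rho>(g) \<rho>(g\<inverse>))\<^sub>j\<^sub>i = |G| \<delta>\<^sub>i\<^sub>j\<close>, which determines \<open>c\<close>.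
\<close>

lemma (in group) matrix_coefficients_norm:
  assumes \<rho>: "irreducible_rep G n \<rho>"
    and ij: "i < n" "j < n" "k < n" "l < n"
  shows "(\<Sum>g\<in>carrier G. \<rho> (inv g) $$ (k, i) * \<rho> g $$ (j, l))
       = (if i = j \<and> k = l then of_nat (Coset.order G) / of_nat n else 0)"
proof -
  define T where
    "T = mat n n (\<lambda>(k, l). \<Sum>g\<in>carrier G. \<rho> (inv g) $$ (k, i) * \<rho> g $$ (j, l))"
  have "\<rho> h * T = T * \<rho> h" if "h \<in> carrier G" for h
    unfolding T_def using rep_averaging_comm[OF irreducible_repD(1)[OF \<rho>] irreducible_repD(1)[OF \<rho>]] ij that
    by blast
  then obtain c where c: "T = c \<cdot>\<^sub>m 1\<^sub>m n"
    using schur_scalar[OF \<rho>, of T] by (auto simp: T_def)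
  have T: "(\<Sum>g\<in>carrier G. \<rho> (inv g) $$ (k, i) * \<rho> g $$ (j, l)) = (if k = l then c else 0)"
    if "k < n" "l < n" for k l
    using arg_cong[OF c, of "\<lambda>T. T $$ (k, l)"] that by (auto simp: T_def)
  have "of_nat n * c = (\<Sum>k<n. \<Sum>g\<in>carrier G. \<rho> (inv g) $$ (k, i) * \<rho> g $$ (j, k))"
    by (simp add: T)
  also have "\<dots> = (\<Sum>g\<in>carrier G. \<rho> (g \<otimes> inv g) $$ (j, i))"
    by (subst sum.swap, rule sum.cong[OF refl], subst rep_mult_entry[OF irreducible_repD(1)[OF \<rho>]])
      (use ij in \<open>auto simp: mult.commute\<close>)
  also have "\<dots> = (if i = j then of_nat (Coset.order G) else 0)"
    using ij rep_one[OF is_group irreducible_repD(1)[OF \<rho>]] by (simp add: Coset.order_def)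
  finally have "c = (if i = j then of_nat (Coset.order G) / of_nat n else 0)"
    using irreducible_repD(2)[OF \<rho>] by (auto simp: field_simps split: if_splits)
  with T ij show ?thesis by auto
qed

text \<open>
  With \<open>A\<^sup>*\<close> the conjugate transpose of \<open>A\<close>, the averaged form \<open>M = \<Sum>g. \<rho>(g)\<^sup>* \<rho>(g)\<close> is invariant under
  the group, that is, \<open>\<rho>(h)\<^sup>* M = M \<rho>(h\<inverse>)\<close>. It is positive definite, hence invertible, so \<open>\<rho>(h)\<^sup>*\<close> is
  similar to \<open>\<rho>(h\<inverse>)\<close> and the two have the same trace.
\<close>

lemma (in group) character_cnj:
  assumes fin: "finite (carrier G)" and \<rho>: "representation G n \<rho>" and h: "h \<in> carrier G"
  shows "cnj (character \<rho> h) = character \<rho> (inv h)"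
proof -
  define M where
    "M = mat n n (\<lambda>(k, l). \<Sum>g\<in>carrier G. \<Sum>p<n. cnj (\<rho> g $$ (p, k)) * \<rho> g $$ (p, l))"
  define S where "S = mat n n (\<lambda>(k, l). cnj (\<rho> h $$ (l, k)))"
  have M: "M \<in> carrier_mat n n" and S: "S \<in> carrier_mat n n" by (simp_all add: M_def S_def)
  note c = rep_carrier_mat[OF \<rho> h] rep_carrier_mat[OF \<rho> inv_closed[OF h]]
  have SM: "S * M = M * \<rho> (inv h)"
  proof (rule eq_matI)
    fix k l assume "k < dim_row (M * \<rho> (inv h))" "l < dim_col (M * \<rho> (inv h))"
    then have kl: "k < n" "l < n" using M c by auto
    have "(S * M) $$ (k, l) = (\<Sum>q<n. \<Sum>g\<in>carrier G. \<Sum>p<n.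
        cnj (\<rho> h $$ (q, k)) * (cnj (\<rho> g $$ (p, q)) * \<rho> g $$ (p, l)))"
      unfolding mult_mat_entry[OF S M kl] using kl by (simp add: S_def M_def sum_distrib_left)
    also have "\<dots> = (\<Sum>g\<in>carrier G. \<Sum>p<n. \<Sum>q<n.
        cnj (\<rho> h $$ (q, k)) * (cnj (\<rho> g $$ (p, q)) * \<rho> g $$ (p, l)))"
      by (rule sum_swap3)
    also have "\<dots> = (\<Sum>g\<in>carrier G. \<Sum>p<n. cnj (\<rho> (g \<otimes> h) $$ (p, k)) * \<rho> g $$ (p, l))"
      using kl h by (auto simp: rep_mult_entry[OF \<rho>] sum_distrib_left sum_distrib_right mult_ac intro!: sum.cong)
    also have "\<dots> = (\<Sum>g\<in>carrier G. \<Sum>p<n. cnj (\<rho> g $$ (p, k)) * \<rho> (g \<otimes> inv h) $$ (p, l))"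
      using h by (intro sum.reindex_bij_witness[of _ "\<lambda>g. g \<otimes> inv h" "\<lambda>g. g \<otimes> h"])
        (auto simp: m_assoc)
    also have "\<dots> = (\<Sum>g\<in>carrier G. \<Sum>p<n. \<Sum>q<n.
        cnj (\<rho> g $$ (p, k)) * (\<rho> g $$ (p, q) * \<rho> (inv h) $$ (q, l)))"
      using kl h by (auto simp: rep_mult_entry[OF \<rho>] sum_distrib_left intro!: sum.cong)
    also have "\<dots> = (\<Sum>q<n. \<Sum>g\<in>carrier G. \<Sum>p<n.
        cnj (\<rho> g $$ (p, k)) * (\<rho> g $$ (p, q) * \<rho> (inv h) $$ (q, l)))"
      by (rule sum_swap3[symmetric])
    also have "\<dots> = (M * \<rho> (inv h)) $$ (k, l)"
      unfolding mult_mat_entry[OF M c(2) kl] using kl by (simp add: M_def sum_distrib_right mult.assoc)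
    finally show "(S * M) $$ (k, l) = (M * \<rho> (inv h)) $$ (k, l)" .
  qed (use S M c in auto)
  \<comment> \<open>Positive definiteness: \<open>v\<^sup>* M v\<close> is the sum of \<open>|\<rho>(g) v|\<^sup>2\<close> over \<open>g\<close>, whose term at \<open>g = 1\<close> is \<open>|v|\<^sup>2\<close>.\<close>
  have "v = 0\<^sub>v n" if v: "v \<in> carrier_vec n" "M *\<^sub>v v = 0\<^sub>v n" for v
  proof -
    have "(\<Sum>l<n. M $$ (k, l) * v $ l) = 0" if "k < n" for k
      using arg_cong[OF v(2), of "\<lambda>w. w $ k"] v(1) M that by (simp add: scalar_prod_lessThan)
    then have "0 = (\<Sum>k<n. cnj (v $ k) * (\<Sum>l<n. M $$ (k, l) * v $ l))" by simp
    also have "\<dots> = (\<Sum>k<n. \<Sum>l<n. \<Sum>g\<in>carrier G. \<Sum>p<n.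
        cnj (\<rho> g $$ (p, k) * v $ k) * (\<rho> g $$ (p, l) * v $ l))"
      by (auto simp: M_def sum_distrib_left sum_distrib_right mult_ac intro!: sum.cong)
    also have "\<dots> = (\<Sum>g\<in>carrier G. \<Sum>p<n. \<Sum>k<n. \<Sum>l<n.
        cnj (\<rho> g $$ (p, k) * v $ k) * (\<rho> g $$ (p, l) * v $ l))"
      by (rule sum_swap_pairs)
    also have "\<dots> = (\<Sum>g\<in>carrier G. \<Sum>p<n. of_real ((cmod (\<Sum>k<n. \<rho> g $$ (p, k) * v $ k))\<^sup>2))"
    proof -
      have "of_real ((cmod z)\<^sup>2) = cnj z * z" for z
        by (simp only: complex_norm_square mult.commute)
      then show ?thesis by (simp add: sum_product del: of_real_power)
    qed
    finally have "of_real (\<Sum>g\<in>carrier G. \<Sum>p<n. (cmod (\<Sum>k<n. \<rho> g $$ (p, k) * v $ k))\<^sup>2)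
        = (0::complex)"
      unfolding of_real_sum by (rule sym)
    then have "(\<Sum>g\<in>carrier G. \<Sum>p<n. (cmod (\<Sum>k<n. \<rho> g $$ (p, k) * v $ k))\<^sup>2) = 0"
      unfolding of_real_eq_0_iff .
    then have "(\<Sum>p<n. (cmod (\<Sum>k<n. \<rho> \<one> $$ (p, k) * v $ k))\<^sup>2) = 0"
      by (subst (asm) sum_nonneg_eq_0_iff[OF fin]) (auto intro: sum_nonneg)
    then have "\<forall>p<n. (cmod (\<Sum>k<n. \<rho> \<one> $$ (p, k) * v $ k))\<^sup>2 = 0"
      by (subst (asm) sum_nonneg_eq_0_iff) auto
    moreover have "(\<Sum>k<n. \<rho> \<one> $$ (p, k) * v $ k) = v $ p" if "p < n" for p
      using that by (simp add: rep_one[OF is_group \<rho>] if_distrib[of "\<lambda>x. x * _"] sum.delta' cong: if_cong)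
    ultimately show "v = 0\<^sub>v n" using v by (intro eq_vecI) auto
  qed
  then have "det M \<noteq> 0" using det_0_iff_vec_prod_zero_field[OF M] by blast
  then obtain Q where Q: "Q \<in> carrier_mat n n" "Q * M = 1\<^sub>m n" "M * Q = 1\<^sub>m n"
    using det_non_zero_imp_unit[OF M, of "()"] by (auto simp: Units_def ring_mat_simps)
  have "cnj (character \<rho> h) = mat_trace S"
    using c by (simp add: character_def mat_trace_def S_def)
  also have "S = S * (M * Q)" using S Q by simp
  also have "\<dots> = M * \<rho> (inv h) * Q"
    unfolding SM[symmetric] using S M Q by (intro assoc_mult_mat[symmetric])
  also have "mat_trace \<dots> = mat_trace (Q * (M * \<rho> (inv h)))"
    using M Q c by (intro mat_trace_comm[of _ n]) auto
  also have "Q * (M * \<rho> (inv h)) = (Q * M) * \<rho> (inv h)"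
    using M Q c by (intro assoc_mult_mat[symmetric])
  also have "mat_trace \<dots> = character \<rho> (inv h)"
    using c by (simp add: Q character_def)
  finally show ?thesis .
qed

lemma (in group) class_inner_characters:
  assumes fin: "finite (carrier G)" and \<rho>: "representation G n \<rho>" and \<sigma>: "representation G m \<sigma>"
  shows "class_inner G (character \<rho>) (character \<sigma>)
       = (\<Sum>k<n. \<Sum>l<m. \<Sum>g\<in>carrier G. \<rho> (inv g) $$ (k, k) * \<sigma> g $$ (l, l)) / of_nat (Coset.order G)"
proof -
  have "(\<Sum>g\<in>carrier G. cnj (character \<rho> g) * character \<sigma> g)
      = (\<Sum>g\<in>carrier G. \<Sum>k<n. \<Sum>l<m. \<rho> (inv g) $$ (k, k) * \<sigma> g $$ (l, l))"
  proof (rule sum.cong[OF refl])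
    fix g assume g: "g \<in> carrier G"
    have "cnj (character \<rho> g) * character \<sigma> g = character \<rho> (inv g) * character \<sigma> g"
      by (simp add: character_cnj[OF fin \<rho> g])
    also have "\<dots> = (\<Sum>k<n. \<Sum>l<m. \<rho> (inv g) $$ (k, k) * \<sigma> g $$ (l, l))"
      using rep_carrier_mat[OF \<rho> inv_closed[OF g]] rep_carrier_mat[OF \<sigma> g]
      by (simp add: character_def mat_trace_def sum_product)
    finally show "cnj (character \<rho> g) * character \<sigma> g
      = (\<Sum>k<n. \<Sum>l<m. \<rho> (inv g) $$ (k, k) * \<sigma> g $$ (l, l))" .
  qed
  also have "\<dots> = (\<Sum>k<n. \<Sum>l<m. \<Sum>g\<in>carrier G. \<rho> (inv g) $$ (k, k) * \<sigma> g $$ (l, l))"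
    by (rule sum_swap3)
  finally show ?thesis by (simp add: class_inner_def)
qed

text \<open>
  The inner product expands into sums of products of diagonal matrix coefficients. For inequivalent
  representations all of them vanish; for \<open>C = D\<close> the \<open>n\<close> pairs with \<open>k = l\<close> contribute \<open>1/n\<close> each.
\<close>

theorem (in group) irr_char_orthonormal:
  assumes fin: "finite (carrier G)" and C: "C \<in> Irr G" and D: "D \<in> Irr G"
  shows "class_inner G (irr_char C) (irr_char D) = (if C = D then 1 else 0)"
proof -
  have "\<exists>x. x \<in> E" if "E \<in> Irr G" for E
    using that in_quotient_imp_non_empty[OF rep_iso_equiv] unfolding Irr_def by blast
  with C D obtain n \<rho> m \<sigma> where x: "(n, \<rho>) \<in> C" and y: "(m, \<sigma>) \<in> D" by (metis surj_pair)
  have "irreducible_rep G n \<rho>" "irreducible_rep G m \<sigma>"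
    using irr_class_related[OF C x x] irr_class_related[OF D y y]
    by (auto simp: rep_iso_def irr_reps_def)
  note \<rho> = this(1) and \<sigma> = this(2)
  have eq: "class_inner G (irr_char C) (irr_char D) = class_inner G (character \<rho>) (character \<sigma>)"
    by (simp add: class_inner_def irr_char_eq[OF C x] irr_char_eq[OF D y])
  show ?thesis
  proof (cases "C = D")
    case True
    have "Coset.order G > 0" using fin by (simp add: order_gt_0_iff_finite)
    have eq: "class_inner G (irr_char C) (irr_char D) = class_inner G (character \<rho>) (character \<rho>)"
      by (simp add: class_inner_def irr_char_eq[OF C x] True[symmetric])
    also have "\<dots> = (\<Sum>k<n. \<Sum>l<n. if k = l then of_nat (Coset.order G) / of_nat n else 0) / of_nat (Coset.order G)"
      unfolding class_inner_characters[OF fin irreducible_repD(1)[OF \<rho>] irreducible_repD(1)[OF \<rho>]]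
      by (simp add: matrix_coefficients_norm[OF \<rho>])
    also have "\<dots> = 1" using irreducible_repD(2)[OF \<rho>] \<open>Coset.order G > 0\<close> by (simp add: field_simps)
    finally show ?thesis using True by simp
  next
    case False
    then have "((m, \<sigma>), (n, \<rho>)) \<notin> rep_iso G"
      using quotient_eq_iff[OF rep_iso_equiv D[unfolded Irr_def] C[unfolded Irr_def] y x] by simp
    then show ?thesis
      unfolding eq class_inner_characters[OF fin irreducible_repD(1)[OF \<rho>] irreducible_repD(1)[OF \<sigma>]]
      using False by (simp add: matrix_coefficients_orthogonal[OF \<rho> \<sigma>])
  qed
qed

section \<open>Bessel's inequality\<close>

lemma class_inner_self:
  "class_inner G f f = of_real ((\<Sum>g\<in>carrier G. (cmod (f g))\<^sup>2) / real (Coset.order G))"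
  by (simp add: class_inner_def mult.commute[of "cnj _"] complex_norm_square[symmetric]
      del: of_real_power)

lemma class_inner_sum_right:
  "class_inner G e (\<lambda>g. \<Sum>x\<in>S. c x * f x g) = (\<Sum>x\<in>S. c x * class_inner G e (f x))"
  unfolding class_inner_def sum_distrib_left
  by (subst sum.swap) (simp add: mult_ac)

lemma class_inner_diff_right:
  "class_inner G e (\<lambda>g. f g - h g) = class_inner G e f - class_inner G e h"
  by (simp add: class_inner_def right_diff_distrib sum_subtractf)

lemma class_inner_commute: "cnj (class_inner G e f) = class_inner G f e"
  by (simp add: class_inner_def mult.commute)

text \<open>
  Subtracting from \<open>f\<close> its projection \<open>p\<close> onto the span of the orthonormal family leaves
  \<open>d = f - p\<close> of squared norm \<open>\<langle>f,f\<rangle> - \<Sum>x. |\<langle>e\<^sub>x,f\<rangle>|\<^sup>2\<close>, which is non-negative.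
\<close>

theorem bessel_class_inner:
  assumes S: "finite S"
    and orth: "\<And>x y. x \<in> S \<Longrightarrow> y \<in> S \<Longrightarrow> class_inner G (e x) (e y) = (if x = y then 1 else 0)"
  shows "(\<Sum>x\<in>S. (cmod (class_inner G (e x) f))\<^sup>2)
      \<le> (\<Sum>g\<in>carrier G. (cmod (f g))\<^sup>2) / real (Coset.order G)"
proof -
  define c where "c x = class_inner G (e x) f" for x
  define p where "p = (\<lambda>g. \<Sum>x\<in>S. c x * e x g)"
  define d where "d = (\<lambda>g. f g - p g)"
  have ed: "class_inner G (e x) d = 0" if x: "x \<in> S" for x
  proof -
    have "class_inner G (e x) p = (\<Sum>y\<in>S. c y * (if x = y then 1 else 0))"
      unfolding p_def class_inner_sum_right using orth x by (intro sum.cong) auto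
    also have "\<dots> = c x" using S x by (simp add: if_distrib[of "(*) _"] sum.delta' cong: if_cong)
    finally show ?thesis by (simp add: d_def class_inner_diff_right c_def)
  qed
  have "class_inner G d p = (\<Sum>x\<in>S. c x * class_inner G d (e x))"
    unfolding p_def by (rule class_inner_sum_right)
  also have "\<dots> = 0"
    using ed by (simp add: class_inner_commute[symmetric, of G d])
  finally have "class_inner G d d = class_inner G d f"
    by (simp add: d_def class_inner_diff_right)
  also have "\<dots> = cnj (class_inner G f d)" by (simp add: class_inner_commute)
  also have "class_inner G f d = class_inner G f f - (\<Sum>x\<in>S. c x * class_inner G f (e x))"
    by (simp add: d_def class_inner_diff_right p_def class_inner_sum_right)
  also have "(\<Sum>x\<in>S. c x * class_inner G f (e x)) = of_real (\<Sum>x\<in>S. (cmod (c x))\<^sup>2)"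
    by (simp add: c_def class_inner_commute[symmetric, of G f] complex_norm_square[symmetric] del: of_real_power)
  finally have "(\<Sum>g\<in>carrier G. (cmod (d g))\<^sup>2) / real (Coset.order G)
      = (\<Sum>g\<in>carrier G. (cmod (f g))\<^sup>2) / real (Coset.order G) - (\<Sum>x\<in>S. (cmod (c x))\<^sup>2)"
    unfolding class_inner_self complex_cnj_diff complex_cnj_complex_of_real
      of_real_diff[symmetric] of_real_eq_iff .
  moreover have "0 \<le> (\<Sum>g\<in>carrier G. (cmod (d g))\<^sup>2) / real (Coset.order G)"
    by (simp add: sum_nonneg)
  ultimately show ?thesis by (simp add: c_def)
qed

section \<open>Conjugacy classes and the permutation character\<close>

lemma (in group) conj_class_eq_image: 
  assumes g: "g \<in> carrier G"
  shows "conj_class G g = (\<lambda>x. inv x \<otimes> g \<otimes> x) ` carrier G"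
proof (intro equalityI subsetI)
  fix y assume "y \<in> conj_class G g"
  then obtain x where "x \<in> carrier G" "y = x \<otimes> g \<otimes> inv x" by (auto simp: conj_class_def)
  then show "y \<in> (\<lambda>x. inv x \<otimes> g \<otimes> x) ` carrier G" by (intro image_eqI[of _ _ "inv x"]) auto
next
  fix y assume "y \<in> (\<lambda>x. inv x \<otimes> g \<otimes> x) ` carrier G"
  then obtain x where "x \<in> carrier G" "y = inv x \<otimes> g \<otimes> x" by auto
  then show "y \<in> conj_class G g" by (auto simp: conj_class_def intro!: exI[of _ "inv x"])
qed

text \<open>
  The elements conjugating \<open>g\<close> to a given conjugate form a coset of the centralizer of \<open>g\<close>, so there
  are equally many for each conjugate.
\<close>

lemma (in group) card_conjugators:
  assumes g: "g \<in> carrier G" and y: "y \<in> conj_class G g"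
  shows "card {x \<in> carrier G. inv x \<otimes> g \<otimes> x = y} = card {x \<in> carrier G. inv x \<otimes> g \<otimes> x = g}"
proof -
  from y obtain a where a: "a \<in> carrier G" and y: "y = inv a \<otimes> g \<otimes> a"
    unfolding conj_class_eq_image[OF g] by auto
  have *: "inv (x \<otimes> b) \<otimes> g \<otimes> (x \<otimes> b) = inv b \<otimes> (inv x \<otimes> g \<otimes> x) \<otimes> b"
    if "x \<in> carrier G" "b \<in> carrier G" for x b
    using that g by (simp add: inv_mult_group m_assoc)
  have conj_undo: "a \<otimes> (inv a \<otimes> g \<otimes> a) \<otimes> inv a = g"
  proof -
    have "a \<otimes> (inv a \<otimes> g \<otimes> a) \<otimes> inv a = (a \<otimes> inv a) \<otimes> g \<otimes> (a \<otimes> inv a)"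
      using a g by (simp only: m_assoc m_closed inv_closed)
    then show ?thesis using a g by simp
  qed
  have "bij_betw (\<lambda>x. x \<otimes> inv a) {x \<in> carrier G. inv x \<otimes> g \<otimes> x = y}
      {x \<in> carrier G. inv x \<otimes> g \<otimes> x = g}"
    using a conj_undo by (intro bij_betwI[where g = "\<lambda>x. x \<otimes> a"]) (auto simp: * y m_assoc)
  then show ?thesis by (rule bij_betw_same_card)
qed

lemma (in group) card_conjugators_into:
  assumes fin: "finite (carrier G)" and g: "g \<in> carrier G"
  shows "card {x \<in> carrier G. inv x \<otimes> g \<otimes> x \<in> H}
    = card (conj_class G g \<inter> H) * card {x \<in> carrier G. inv x \<otimes> g \<otimes> x = g}"
proof -
  have fc: "finite (conj_class G g)" unfolding conj_class_eq_image[OF g] using fin by simp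
  have "{x \<in> carrier G. inv x \<otimes> g \<otimes> x \<in> H}
      = (\<Union>y\<in>conj_class G g \<inter> H. {x \<in> carrier G. inv x \<otimes> g \<otimes> x = y})"
    unfolding conj_class_eq_image[OF g] by auto
  also have "card \<dots> = (\<Sum>y\<in>conj_class G g \<inter> H. card {x \<in> carrier G. inv x \<otimes> g \<otimes> x = y})"
    using fc fin by (intro card_UN_disjoint) auto
  also have "\<dots> = (\<Sum>y\<in>conj_class G g \<inter> H. card {x \<in> carrier G. inv x \<otimes> g \<otimes> x = g})"
    by (intro sum.cong) (auto simp: card_conjugators[OF g])
  finally show ?thesis by simp
qed

text \<open>
  Let \<open>z\<close> be the order of the centralizer of \<open>g\<close>. Counting fibres of \<open>x \<mapsto> x\<inverse> g x\<close> gives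
  \<open>|H| Ind(g) = z |g\<^sup>G \<inter> H|\<close>, and the same count with \<open>G\<close> in place of \<open>H\<close> gives \<open>|G| = z |g\<^sup>G|\<close>.
\<close>

lemma (in group) Ind_one_fixed_ratio:
  assumes fin: "finite (carrier G)" and H: "subgroup H G" and g: "g \<in> carrier G"
  shows "of_nat (card H) / of_nat (Coset.order G) * Ind_one G H g
    = of_real (real (card (conj_class G g \<inter> H)) / real (card (conj_class G g)))"
proof -
  let ?z = "card {x \<in> carrier G. inv x \<otimes> g \<otimes> x = g}"
  have G: "Coset.order G = card (conj_class G g) * ?z"
  proof -
    have "conj_class G g \<subseteq> carrier G" unfolding conj_class_eq_image[OF g] using g by auto
    moreover have "{x \<in> carrier G. inv x \<otimes> g \<otimes> x \<in> carrier G} = carrier G" using g by auto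
    ultimately show ?thesis
      using card_conjugators_into[OF fin g, of "carrier G"] by (simp add: Coset.order_def Int_absorb2)
  qed
  have "card H > 0"
    using subgroup.finite_imp_card_positive[OF H] fin by simp
  moreover have "Coset.order G > 0" using fin by (simp add: order_gt_0_iff_finite)
  ultimately show ?thesis
    unfolding Ind_def by (simp add: card_conjugators_into[OF fin g] G field_simps)
qed

lemma (in group) Ind_one_at_one:
  assumes fin: "finite (carrier G)" and H: "subgroup H G"
  shows "of_nat (card H) / of_nat (Coset.order G) * Ind_one G H \<one> = 1"
proof -
  have "conj_class G \<one> = {\<one>}" unfolding conj_class_eq_image[OF one_closed] by auto
  then show ?thesis
    unfolding Ind_one_fixed_ratio[OF fin H one_closed] using subgroup.one_closed[OF H] by simp
qed

section \<open>Distance to the Plancherel measure\<close>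

lemma (in group) irr_char_one:
  assumes "C \<in> Irr G"
  shows "irr_char C \<one> = of_nat (irr_dim C)" "irr_dim C > 0"
proof -
  obtain n \<rho> where x: "(n, \<rho>) \<in> C"
    using assms in_quotient_imp_non_empty[OF rep_iso_equiv] unfolding Irr_def by (metis ex_in_conv surj_pair)
  have \<rho>: "irreducible_rep G n \<rho>"
    using irr_class_related[OF assms x x] by (simp add: rep_iso_def irr_reps_def)
  show "irr_char C \<one> = of_nat (irr_dim C)" "irr_dim C > 0"
    using character_one[OF is_group irreducible_repD(1)[OF \<rho>]] irreducible_repD(2)[OF \<rho>]
    by (simp_all add: irr_char_eq[OF assms x] irr_dim_eq[OF assms x])
qed

text \<open>
  Bessel's inequality for the indicator \<open>\<delta>\<close> of the identity: \<open>\<langle>\<chi>,\<delta>\<rangle> = dim/|G|\<close> and \<open>\<langle>\<delta>,\<delta>\<rangle> = 1/|G|\<close>.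
  The statement is about finite sets of classes because it serves to prove that \<open>Irr G\<close> is finite:
  every dimension is at least \<open>1\<close>.
\<close>

lemma (in group) sum_irr_dim_square_le:
  assumes fin: "finite (carrier G)" and S: "finite S" "S \<subseteq> Irr G"
  shows "(\<Sum>C\<in>S. (real (irr_dim C))\<^sup>2) \<le> real (Coset.order G)"
proof -
  define \<delta> :: "'a \<Rightarrow> complex" where "\<delta> = (\<lambda>g. if g = \<one> then 1 else 0)"
  have pos: "Coset.order G > 0" using fin by (simp add: order_gt_0_iff_finite)
  have "class_inner G (irr_char C) \<delta> = of_nat (irr_dim C) / of_nat (Coset.order G)" if "C \<in> S" for C
  proof -
    have "(\<Sum>g\<in>carrier G. cnj (irr_char C g) * \<delta> g)
        = (\<Sum>g\<in>carrier G. if g = \<one> then cnj (irr_char C g) else 0)"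
      by (intro sum.cong) (auto simp: \<delta>_def)
    also have "\<dots> = of_nat (irr_dim C)"
      using fin S that by (simp add: irr_char_one subset_iff)
    finally show ?thesis by (simp add: class_inner_def)
  qed
  then have "(\<Sum>C\<in>S. (real (irr_dim C) / real (Coset.order G))\<^sup>2)
      = (\<Sum>C\<in>S. (cmod (class_inner G (irr_char C) \<delta>))\<^sup>2)"
    by (intro sum.cong) (auto simp: norm_divide)
  also have "\<dots> \<le> (\<Sum>g\<in>carrier G. (cmod (\<delta> g))\<^sup>2) / real (Coset.order G)"
    using S by (intro bessel_class_inner irr_char_orthonormal[OF fin]) auto
  also have "(\<Sum>g\<in>carrier G. (cmod (\<delta> g))\<^sup>2) = (\<Sum>g\<in>carrier G. if g = \<one> then 1 else 0)"
    by (intro sum.cong) (auto simp: \<delta>_def)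
  also have "\<dots> = 1" using fin by simp
  finally have "(\<Sum>C\<in>S. (real (irr_dim C))\<^sup>2) / (real (Coset.order G))\<^sup>2 \<le> 1 / real (Coset.order G)"
    by (simp add: power_divide sum_divide_distrib)
  then show ?thesis using pos by (simp add: field_simps power2_eq_square)
qed

lemma (in group) finite_Irr:
  assumes fin: "finite (carrier G)"
  shows "finite (Irr G)"
proof (rule ccontr)
  assume "infinite (Irr G)"
  then obtain S where S: "finite S" "card S = Suc (Coset.order G)" "S \<subseteq> Irr G"
    using infinite_arbitrarily_large by blast
  have "real (card S) = (\<Sum>C\<in>S. 1)" by simp
  also have "\<dots> \<le> (\<Sum>C\<in>S. (real (irr_dim C))\<^sup>2)"
    using irr_char_one(2) S(3) by (intro sum_mono) (auto simp: subset_iff Suc_le_eq)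
  also have "\<dots> \<le> real (Coset.order G)" by (rule sum_irr_dim_square_le[OF fin S(1,3)])
  finally show False using S(2) by simp
qed

text \<open>
  The value of \<open>f\<close> at the identity contributes exactly the Plancherel weight \<open>dim\<^sup>2/|G|\<close>, so each summand
  is \<open>dim |\<langle>\<chi>,f'\<rangle>|\<close>, where \<open>f'\<close> agrees with \<open>f\<close> off the identity and is \<open>0\<close> there. The Cauchy-Schwarz
  inequality splits the sum into \<open>\<Sum> dim\<^sup>2 \<le> |G|\<close> and, by Bessel, \<open>\<Sum> |\<langle>\<chi>,f'\<rangle>|\<^sup>2 \<le> \<langle>f',f'\<rangle> \<le> B\<^sup>2\<close>.
\<close>

theorem (in group) plancherel_distance_le:
  assumes fin: "finite (carrier G)" and f1: "f \<one> = 1"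
    and B: "\<And>g. g \<in> carrier G \<Longrightarrow> g \<noteq> \<one> \<Longrightarrow> cmod (f g) \<le> B" "0 \<le> B"
  shows "(\<Sum>C\<in>Irr G. cmod (of_nat (irr_dim C) * class_inner G (irr_char C) f
           - of_real (plancherel G C))) \<le> sqrt (real (Coset.order G)) * B"
proof -
  define f' where "f' = (\<lambda>g. if g = \<one> then 0 else f g)"
  define c where "c C = class_inner G (irr_char C) f'" for C
  let ?N = "real (Coset.order G)"
  have pos: "?N > 0" using fin by (simp add: order_gt_0_iff_finite)
  have summand: "cmod (of_nat (irr_dim C) * class_inner G (irr_char C) f - of_real (plancherel G C))
      = real (irr_dim C) * cmod (c C)" if C: "C \<in> Irr G" for C
  proof -
    have "(\<Sum>g\<in>carrier G. cnj (irr_char C g) * f g) = of_nat (irr_dim C) +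
        (\<Sum>g\<in>carrier G. cnj (irr_char C g) * f' g)"
      by (simp add: sum.remove[OF fin one_closed] f1 f'_def irr_char_one[OF C])
    then have "class_inner G (irr_char C) f = of_nat (irr_dim C) / of_nat (Coset.order G) + c C"
      by (simp add: class_inner_def c_def add_divide_distrib)
    then have "of_nat (irr_dim C) * class_inner G (irr_char C) f - of_real (plancherel G C)
        = of_nat (irr_dim C) * c C"
      by (simp add: plancherel_def power2_eq_square algebra_simps)
    then show ?thesis by (simp add: norm_mult)
  qed
  have "(\<Sum>g\<in>carrier G. (cmod (f' g))\<^sup>2) \<le> (\<Sum>g\<in>carrier G. B\<^sup>2)"
    using B by (intro sum_mono power_mono) (auto simp: f'_def)
  also have "\<dots> = ?N * B\<^sup>2" by (simp add: Coset.order_def)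
  finally have f': "(\<Sum>g\<in>carrier G. (cmod (f' g))\<^sup>2) / ?N \<le> B\<^sup>2"
    using pos by (simp add: field_simps)
  have c: "L2_set (\<lambda>C. cmod (c C)) (Irr G) \<le> B"
    unfolding L2_set_def c_def using B(2)
    by (intro real_le_lsqrt order.trans[OF bessel_class_inner f']
        irr_char_orthonormal[OF fin] finite_Irr[OF fin])
  have d: "L2_set (\<lambda>C. real (irr_dim C)) (Irr G) \<le> sqrt ?N"
    unfolding L2_set_def
    by (intro real_sqrt_le_mono sum_irr_dim_square_le fin finite_Irr order.refl)
  have "(\<Sum>C\<in>Irr G. real (irr_dim C) * cmod (c C))
      \<le> L2_set (\<lambda>C. real (irr_dim C)) (Irr G) * L2_set (\<lambda>C. cmod (c C)) (Irr G)"
    using L2_set_mult_ineq[of "\<lambda>C. real (irr_dim C)" "\<lambda>C. cmod (c C)" "Irr G"] by simp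
  also have "\<dots> \<le> sqrt ?N * B"
    using c d by (intro mult_mono) (auto simp: L2_set_nonneg)
  finally have "(\<Sum>C\<in>Irr G. real (irr_dim C) * cmod (c C)) \<le> sqrt ?N * B" .
  then show ?thesis by (simp add: summand)
qed

theorem theorem1p1:
  fixes G :: "('a, 'b) monoid_scheme" (structure)
    and H :: "'a set" and \<beta> :: real
  assumes "group G" and "finite (carrier G)" and "Coset.order G > 1" and "subgroup H G"
    and "\<beta> = (MAX g\<in>carrier G - {\<one>}.
               real (card (conj_class G g \<inter> H)) / real (card (conj_class G g)))"
  shows "\<beta> = real (card H) / real (Coset.order G) * (MAX g\<in>carrier G - {\<one>}. Re (Ind_one G H g)) \<and>
    (\<forall>r::nat. r > 0 \<longrightarrow>
      (\<Sum>\<rho>\<in>Irr G.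
         cmod ((of_nat (card H) / of_nat (Coset.order G)) ^ r * of_nat (irr_dim \<rho>) *
                 class_inner G (irr_char \<rho>) (\<lambda>g. Ind_one G H g ^ r)
               - of_real (plancherel G \<rho>)))
      \<le> sqrt (real (Coset.order G)) * \<beta> ^ r)"
proof -
  interpret group G by fact
  note fin = \<open>finite (carrier G)\<close> and H = \<open>subgroup H G\<close>
  let ?h = "real (card H) / real (Coset.order G)"
  let ?q = "\<lambda>g. real (card (conj_class G g \<inter> H)) / real (card (conj_class G g))"
  have A: "finite (carrier G - {\<one>})" "carrier G - {\<one>} \<noteq> {}"
  proof -
    show "carrier G - {\<one>} \<noteq> {}"
    proof
      assume "carrier G - {\<one>} = {}"
      then have "carrier G \<subseteq> {\<one>}" by blast
      then have "card (carrier G) \<le> card {\<one>}" by (intro card_mono) auto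
      with \<open>Coset.order G > 1\<close> show False by (simp add: Coset.order_def)
    qed
  qed (use fin in simp)
  have q: "of_real ?h * Ind_one G H g = of_real (?q g)" if "g \<in> carrier G" for g
    using Ind_one_fixed_ratio[OF fin H that] by simp
  have Re: "?h * Re (Ind_one G H g) = ?q g" if "g \<in> carrier G" for g
    using arg_cong[OF q[OF that], of Re] by simp
  have "?h * (MAX g\<in>carrier G - {\<one>}. Re (Ind_one G H g))
      = Max ((\<lambda>x. ?h * x) ` (\<lambda>g. Re (Ind_one G H g)) ` (carrier G - {\<one>}))"
  proof (rule mono_Max_commute)
    show "mono (\<lambda>x. ?h * x)" by (intro monoI mult_left_mono) auto
  qed (use A in auto)
  also have "\<dots> = \<beta>"
    unfolding image_image using Re assms(5) by (auto intro!: arg_cong[of _ _ Max] image_cong)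
  finally have max: "\<beta> = ?h * (MAX g\<in>carrier G - {\<one>}. Re (Ind_one G H g))" by simp
  have q_le: "?q g \<le> \<beta>" if "g \<in> carrier G" "g \<noteq> \<one>" for g
    unfolding assms(5) using A that by (intro Max_ge) auto
  from A obtain g0 where "g0 \<in> carrier G" "g0 \<noteq> \<one>" by blast
  from q_le[OF this] have "0 \<le> \<beta>" by (rule order.trans[rotated]) simp
  have "(\<Sum>\<rho>\<in>Irr G. cmod ((of_nat (card H) / of_nat (Coset.order G)) ^ r * of_nat (irr_dim \<rho>) *
                 class_inner G (irr_char \<rho>) (\<lambda>g. Ind_one G H g ^ r)
               - of_real (plancherel G \<rho>))) \<le> sqrt (real (Coset.order G)) * \<beta> ^ r" for r
  proof -
    \<comment> \<open>The factor \<open>(|H|/|G|)\<^sup>r\<close> normalizes the power of the permutation character to value \<open>1\<close> at \<open>\<one>\<close>.\<close>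
    define f where "f g = (of_real ?h * Ind_one G H g) ^ r" for g
    have f: "class_inner G \<chi> f = of_real ?h ^ r * class_inner G \<chi> (\<lambda>g. Ind_one G H g ^ r)" for \<chi>
      unfolding class_inner_def f_def sum_distrib_left
      by (intro sum.cong) (auto simp: power_mult_distrib power_divide mult_ac)
    have "(\<Sum>\<rho>\<in>Irr G. cmod (of_nat (irr_dim \<rho>) * class_inner G (irr_char \<rho>) f
        - of_real (plancherel G \<rho>))) \<le> sqrt (real (Coset.order G)) * \<beta> ^ r"
    proof (rule plancherel_distance_le[OF fin])
      show "f \<one> = 1" using Ind_one_at_one[OF fin H] by (simp add: f_def)
      show "cmod (f g) \<le> \<beta> ^ r" if "g \<in> carrier G" "g \<noteq> \<one>" for g
        unfolding f_def q[OF that(1)] norm_power norm_of_real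
        using q_le[OF that] by (intro power_mono) auto
    qed (use \<open>0 \<le> \<beta>\<close> in simp)
    then show ?thesis unfolding f by (simp add: mult_ac)
  qed
  with max show ?thesis by blast
qed

end
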